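(* Let $\mathcal{P}$ be a two-orbit $n$-polytope in the class $2_I$, with $I\subsetneq N=\{0,\ldots,n-1\}$, let $\bar I:=N\setminus I$, and let $-1\le i\le j\le n$. Let $\mathcal{S}_{i,j}(\mathcal{P})$ be the set of all sections $G/F$ of $\mathcal{P}$ with $F$ an $i$-face, $G$ a $j$-face and $F\le G$. (a) If $\bar{I}\not\subseteq\{i,j\}$, then $\Gamma(\mathcal{P})$ acts transitively on $\mathcal{S}_{i,j}(\mathcal{P})$; in particular any two sections in $\mathcal{S}_{i,j}(\mathcal{P})$ are isomorphic. (b) If $\bar{I}\subseteq\{i,j\}$, then $\Gamma(\mathcal{P})$ has two orbits on $\mathcal{S}_{i,j}(\mathcal{P})$, and these are represented by the two sections $\Phi_j/\Phi_i$ and $\Phi^k_j/\Phi^k_i$, where $k$ is any element of $N$ with $k\notin I$ and $\Phi,\Phi^k$ is any pair of $k$-adjacent flags of $\mathcal{P}$.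
   Context: An (abstract) polytope of rank $n$ is a partially ordered set $\mathcal{P}$ with a strictly monotone rank function onto $\{-1,\ldots,n\}$, with a unique least face (rank $-1$) and unique greatest face (rank $n$), whose maximal chains (flags) each contain exactly $n+2$ faces (one of each rank), satisfying the diamond condition (if $F\le G$ with ranks $j-1$ and $j+1$, $0\le j\le n-1$, there are exactly two $j$-faces between them) and strongly flag-connected (any two flags $\Phi,\Psi$ are joined by a sequence of flags, all containing $\Phi\cap\Psi$, successive ones differing in exactly one face). For a flag $\Phi$, $\Phi_i$ denotes its face of rank $i$; for $k\in N$, $\Phi^k$ is the unique flag differing from $\Phi$ exactly in its $k$-face, and $\Phi^k_i:=(\Phi^k)_i$. For faces $F\le G$ the section is $G/F=\{H: F\le H\le G\}$. $\Gamma(\mathcal{P})$ is the automorphism group. $\mathcal{P}$ is a two-orbit polytope if $\Gamma(\mathcal{P})$ has exactly two orbits on flags; for such $\mathcal{P}$ the set $I$ of $i\in N$ for which $\Phi$ and $\Phi^i$ lie in the same $\Gamma(\mathcal{P})$-orbit is independent of $\Phi$ and is a proper subset of $N$, and $\mathcal{P}$ is said to be in class $2_I$. *)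

theory Defs
  imports "HOL-Algebra.Group_Action"
begin

definition flags :: "'a set \<Rightarrow> 'a rel \<Rightarrow> 'a set set" where
  "flags P r = {\<Phi>. \<Phi> \<subseteq> P \<and> \<Phi> \<in> Chains r \<and> (\<forall>C \<in> Chains r. C \<subseteq> P \<and> \<Phi> \<subseteq> C \<longrightarrow> C = \<Phi>)}"

definition differ_in_one_face :: "'a set \<Rightarrow> 'a set \<Rightarrow> bool" where
  "differ_in_one_face \<Phi> \<Psi> \<longleftrightarrow> (\<exists>F G. \<Phi> - \<Psi> = {F} \<and> \<Psi> - \<Phi> = {G})"

text \<open>The rank \<open>n\<close> is an integer since ranks start at \<open>-1\<close>.\<close>

locale abstract_polytope =
  fixes P :: "'a set" and r :: "'a rel" and rk :: "'a \<Rightarrow> int" and n :: int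
  assumes rank_ge: "-1 \<le> n"
    and partial_order: "partial_order_on P r"
    and rank_strict_mono: "\<And>F G. (F, G) \<in> r \<Longrightarrow> F \<noteq> G \<Longrightarrow> rk F < rk G"
    and rank_onto: "rk ` P = {-1..n}"
    and least_face: "\<exists>!F. F \<in> P \<and> (\<forall>G\<in>P. (F, G) \<in> r)"
      "\<And>F. F \<in> P \<Longrightarrow> (\<forall>G\<in>P. (F, G) \<in> r) \<Longrightarrow> rk F = -1"
    and greatest_face: "\<exists>!G. G \<in> P \<and> (\<forall>F\<in>P. (F, G) \<in> r)"
      "\<And>G. G \<in> P \<Longrightarrow> (\<forall>F\<in>P. (F, G) \<in> r) \<Longrightarrow> rk G = n"
    and flag_card: "\<And>\<Phi>. \<Phi> \<in> flags P r \<Longrightarrow> int (card \<Phi>) = n + 2"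
    and flag_ranks: "\<And>\<Phi> i. \<Phi> \<in> flags P r \<Longrightarrow> i \<in> {-1..n} \<Longrightarrow> \<exists>!F. F \<in> \<Phi> \<and> rk F = i"
    and diamond: "\<And>F G j. (F, G) \<in> r \<Longrightarrow> j \<in> {0..n - 1} \<Longrightarrow> rk F = j - 1 \<Longrightarrow> rk G = j + 1 \<Longrightarrow>
      card {H \<in> P. rk H = j \<and> (F, H) \<in> r \<and> (H, G) \<in> r} = 2"
    and strongly_flag_connected: "\<And>\<Phi> \<Psi>. \<Phi> \<in> flags P r \<Longrightarrow> \<Psi> \<in> flags P r \<Longrightarrow>
      (\<Phi>, \<Psi>) \<in> {(X, Y). X \<in> flags P r \<and> Y \<in> flags P r \<and>
        \<Phi> \<inter> \<Psi> \<subseteq> X \<and> \<Phi> \<inter> \<Psi> \<subseteq> Y \<and> differ_in_one_face X Y}\<^sup>*"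

definition face_of_rank :: "('a \<Rightarrow> int) \<Rightarrow> 'a set \<Rightarrow> int \<Rightarrow> 'a" where
  "face_of_rank rk \<Phi> i = (THE F. F \<in> \<Phi> \<and> rk F = i)"

definition adj_flag :: "'a set \<Rightarrow> 'a rel \<Rightarrow> ('a \<Rightarrow> int) \<Rightarrow> int \<Rightarrow> 'a set \<Rightarrow> 'a set" where
  "adj_flag P r rk k \<Phi> = (THE \<Psi>. \<Psi> \<in> flags P r \<and>
     \<Phi> - \<Psi> = {face_of_rank rk \<Phi> k} \<and> \<Psi> - \<Phi> = {face_of_rank rk \<Psi> k})"

definition face_section :: "'a set \<Rightarrow> 'a rel \<Rightarrow> 'a \<Rightarrow> 'a \<Rightarrow> 'a set" where
  "face_section P r G F = {H \<in> P. (F, H) \<in> r \<and> (H, G) \<in> r}"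

definition sections :: "'a set \<Rightarrow> 'a rel \<Rightarrow> ('a \<Rightarrow> int) \<Rightarrow> int \<Rightarrow> int \<Rightarrow> 'a set set" where
  "sections P r rk i j =
     {face_section P r G F | F G. F \<in> P \<and> G \<in> P \<and> (F, G) \<in> r \<and> rk F = i \<and> rk G = j}"

definition poset_isomorphic :: "'a rel \<Rightarrow> 'a set \<Rightarrow> 'a set \<Rightarrow> bool" where
  "poset_isomorphic r S T \<longleftrightarrow>
     (\<exists>f. bij_betw f S T \<and> (\<forall>x\<in>S. \<forall>y\<in>S. (f x, f y) \<in> r \<longleftrightarrow> (x, y) \<in> r))"

definition aut_group :: "'a set \<Rightarrow> 'a rel \<Rightarrow> ('a \<Rightarrow> 'a) monoid" where
  "aut_group P r = (BijGroup P)
     \<lparr>carrier := {g \<in> Bij P. \<forall>F\<in>P. \<forall>G\<in>P. (g F, g G) \<in> r \<longleftrightarrow> (F, G) \<in> r}\<rparr>"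

text \<open>The induced action on a family \<open>E\<close> of sets of faces (flags or sections), made extensional
  as \<^const>\<open>group_action\<close> requires.\<close>

definition set_action :: "'a set set \<Rightarrow> ('a \<Rightarrow> 'a) \<Rightarrow> 'a set \<Rightarrow> 'a set" where
  "set_action E g = (\<lambda>X\<in>E. g ` X)"

definition two_orbit :: "'a set \<Rightarrow> 'a rel \<Rightarrow> bool" where
  "two_orbit P r \<longleftrightarrow> card (orbits (aut_group P r) (flags P r) (set_action (flags P r))) = 2"

text \<open>For a two-orbit polytope the set of \<open>i\<close> with \<open>\<Phi>\<close> and \<open>\<Phi>\<^sup>i\<close> in the same orbit does not
  depend on the flag \<open>\<Phi>\<close>, so quantifying over all flags or over one flag amounts to the same.\<close>

definition in_class_two :: "'a set \<Rightarrow> 'a rel \<Rightarrow> ('a \<Rightarrow> int) \<Rightarrow> int \<Rightarrow> int set \<Rightarrow> bool" where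
  "in_class_two P r rk n I \<longleftrightarrow> two_orbit P r \<and>
     (\<forall>\<Phi>\<in>flags P r. I = {i \<in> {0..n - 1}.
        adj_flag P r rk i \<Phi> \<in> orbit (aut_group P r) (set_action (flags P r)) \<Phi>})"

end

theory Submission
  imports Defs
begin

text \<open>Every section of type \<open>(i, j)\<close> is cut out by a flag, and two sections are equivalent iff they
  are cut out by equivalent flags. For \<open>k \<notin> I\<close> the flags \<open>\<Phi>\<close> and \<open>\<Phi>\<^sup>k\<close> represent the two flag
  orbits, so their sections represent all section orbits. If \<open>k\<close> can be chosen outside \<open>{i, j}\<close>,
  both flags cut out the same section. Otherwise, an automorphism matching their sections would
  move \<open>\<Phi>\<close> to a flag sharing its \<open>i\<close>- and \<open>j\<close>-face with \<open>\<Phi>\<^sup>k\<close>; strong flag-connectedness joins these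
  two flags by adjacencies of ranks outside \<open>{i, j}\<close>, hence in \<open>I\<close>, so they would lie in one
  orbit.\<close>

section \<open>Automorphisms of a poset and their action on families of subsets\<close>

lemma aut_carrier:
  "carrier (aut_group P r) = {g \<in> Bij P. \<forall>F\<in>P. \<forall>G\<in>P. (g F, g G) \<in> r \<longleftrightarrow> (F, G) \<in> r}"
  by (simp add: aut_group_def)

lemma aut_closed: "g \<in> carrier (aut_group P r) \<Longrightarrow> x \<in> P \<Longrightarrow> g x \<in> P"
  using Bij_imp_funcset by (auto simp: aut_carrier)

lemma aut_iff:
  "g \<in> carrier (aut_group P r) \<Longrightarrow> x \<in> P \<Longrightarrow> y \<in> P \<Longrightarrow> (g x, g y) \<in> r \<longleftrightarrow> (x, y) \<in> r"
  by (simp add: aut_carrier)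

lemma aut_inj_on: "g \<in> carrier (aut_group P r) \<Longrightarrow> inj_on g P"
  by (auto simp: aut_carrier Bij_def bij_betw_def)

text \<open>An automorphism reflects the order as well as preserving it, so its inverse is again an
  automorphism. Restricting \<open>inv_into\<close> to \<open>P\<close> keeps the map extensional,
  as \<open>Bij\<close> requires.\<close>

lemma aut_inverse:
  assumes "g \<in> carrier (aut_group P r)"
  obtains h where "h \<in> carrier (aut_group P r)"
    "\<And>x. x \<in> P \<Longrightarrow> h (g x) = x" "\<And>x. x \<in> P \<Longrightarrow> g (h x) = x"
    "h = inv\<^bsub>BijGroup P\<^esub> g"
proof -
  define h where "h = (\<lambda>x\<in>P. inv_into P g x)"
  have g: "g \<in> Bij P" "bij_betw g P P"
    using assms by (auto simp: aut_carrier Bij_def)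
  have h: "h \<in> Bij P" unfolding h_def using g(1) by (rule restrict_inv_into_Bij)
  have hP: "h x \<in> P" if "x \<in> P" for x using h that Bij_imp_funcset by blast
  have hg: "h (g x) = x" if "x \<in> P" for x
    using g(2) that by (simp add: h_def bij_betw_def image_subset_iff)
      (metis imageI)
  have gh: "g (h x) = x" if "x \<in> P" for x
    using g(2) that by (simp add: h_def bij_betw_def f_inv_into_f)
  have "(h x, h y) \<in> r \<longleftrightarrow> (x, y) \<in> r" if "x \<in> P" "y \<in> P" for x y
    using aut_iff[OF assms, of "h x" "h y"] hP gh that by simp
  then have "h \<in> carrier (aut_group P r)" using h by (simp add: aut_carrier)
  moreover have "h = inv\<^bsub>BijGroup P\<^esub> g" using inv_BijGroup[OF g(1)] by (simp add: h_def)
  ultimately show thesis using that hg gh by blast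
qed

lemma aut_subgroup: "subgroup (carrier (aut_group P r)) (BijGroup P)"
proof (rule subgroup.intro)
  show "carrier (aut_group P r) \<subseteq> carrier (BijGroup P)"
    by (auto simp: aut_carrier BijGroup_def)
  show "x \<otimes>\<^bsub>BijGroup P\<^esub> y \<in> carrier (aut_group P r)"
    if "x \<in> carrier (aut_group P r)" "y \<in> carrier (aut_group P r)" for x y
  proof -
    have "compose P x y \<in> Bij P" using that by (simp add: aut_carrier compose_Bij)
    moreover have "(compose P x y F, compose P x y G) \<in> r \<longleftrightarrow> (F, G) \<in> r" if "F \<in> P" "G \<in> P" for F G
      using \<open>x \<in> _\<close> \<open>y \<in> _\<close> that by (simp add: compose_eq aut_iff aut_closed)
    ultimately show ?thesis
      using that by (simp add: aut_carrier BijGroup_def)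
  qed
  show "\<one>\<^bsub>BijGroup P\<^esub> \<in> carrier (aut_group P r)"
    by (simp add: aut_carrier BijGroup_def id_Bij)
  show "inv\<^bsub>BijGroup P\<^esub> x \<in> carrier (aut_group P r)" if "x \<in> carrier (aut_group P r)" for x
    using that by (metis aut_inverse)
qed

lemma group_aut_group: "group (aut_group P r)"
  using subgroup.subgroup_is_group[OF aut_subgroup group_BijGroup, of P r]
  by (simp add: aut_group_def)

lemma aut_mult:
  "g \<in> carrier (aut_group P r) \<Longrightarrow> h \<in> carrier (aut_group P r) \<Longrightarrow> x \<in> P \<Longrightarrow>
    (g \<otimes>\<^bsub>aut_group P r\<^esub> h) x = g (h x)"
  by (simp add: aut_group_def BijGroup_def compose_eq)

section \<open>Induced actions on families of subsets, and their orbits\<close>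

text \<open>Since \<open>E\<close> is invariant under an automorphism and under its inverse, the two
  induced maps are mutually inverse on \<open>E\<close>. Flags and sections are both
  instances.\<close>

lemma group_action_set_action:
  assumes sub: "\<And>X. X \<in> E \<Longrightarrow> X \<subseteq> P"
    and inv: "\<And>g X. g \<in> carrier (aut_group P r) \<Longrightarrow> X \<in> E \<Longrightarrow> g ` X \<in> E"
  shows "group_action (aut_group P r) E (set_action E)"
proof -
  have bij: "set_action E g \<in> Bij E" if g: "g \<in> carrier (aut_group P r)" for g
  proof -
    obtain h where h: "h \<in> carrier (aut_group P r)"
      "\<And>x. x \<in> P \<Longrightarrow> h (g x) = x" "\<And>x. x \<in> P \<Longrightarrow> g (h x) = x"
      using aut_inverse[OF g] by metis
    have "h ` g ` X = X" "g ` h ` X = X" if "X \<in> E" for X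
      unfolding image_image using h(2,3) sub[OF that] by (simp_all add: subset_iff cong: image_cong)
    then have "bij_betw (set_action E g) E E"
      using inv[OF g] inv[OF h(1)]
      by (intro bij_betw_byWitness[where f' = "set_action E h"])
        (simp_all add: set_action_def image_subset_iff)
    then show ?thesis by (simp add: Bij_def set_action_def)
  qed
  have "set_action E (g \<otimes>\<^bsub>aut_group P r\<^esub> h) = compose E (set_action E g) (set_action E h)"
    if "g \<in> carrier (aut_group P r)" "h \<in> carrier (aut_group P r)" for g h
  proof
    fix X
    have "(g \<otimes>\<^bsub>aut_group P r\<^esub> h) ` X = g ` h ` X" if "X \<in> E"
      using aut_mult[OF \<open>g \<in> _\<close> \<open>h \<in> _\<close>] sub[OF that] by (simp add: image_image subset_iff)
    then show "set_action E (g \<otimes>\<^bsub>aut_group P r\<^esub> h) X = compose E (set_action E g) (set_action E h) X"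
      using inv that by (auto simp: set_action_def compose_def)
  qed
  then have "set_action E \<in> hom (aut_group P r) (BijGroup E)"
    using bij by (auto simp: hom_def BijGroup_def)
  then show ?thesis
    by (simp add: group_action_def group_hom_def group_hom_axioms_def group_aut_group group_BijGroup)
qed

lemma orbit_set_action_iff:
  "X \<in> E \<Longrightarrow> Y \<in> orbit (aut_group P r) (set_action E) X \<longleftrightarrow>
    (\<exists>g \<in> carrier (aut_group P r). g ` X = Y)"
  by (auto simp: orbit_def set_action_def)

text \<open>Orbits partition \<open>E\<close>, so two orbits with a common point coincide.\<close>

lemma (in group_action) orbit_eq_iff:
  assumes "x \<in> E" "y \<in> E"
  shows "orbit G \<phi> x = orbit G \<phi> y \<longleftrightarrow> y \<in> orbit G \<phi> x"
proof
  assume "orbit G \<phi> x = orbit G \<phi> y"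
  then show "y \<in> orbit G \<phi> x" using orbit_refl assms by simp
next
  assume "y \<in> orbit G \<phi> x"
  then have "orbit G \<phi> x \<inter> orbit G \<phi> y \<noteq> {}" using orbit_refl assms by blast
  moreover have "orbit G \<phi> x \<in> orbits G E \<phi>" "orbit G \<phi> y \<in> orbits G E \<phi>"
    using assms by (auto simp: orbits_def)
  ultimately show "orbit G \<phi> x = orbit G \<phi> y" using disjoint_union by blast
qed

section \<open>Images of flags and sections under automorphisms\<close>

text \<open>Maximality is pulled back: the inverse carries a chain containing the image of \<Phi> to
  a chain containing \<Phi>, hence to \<Phi> itself.\<close>

lemma aut_image_flag:
  assumes g: "g \<in> carrier (aut_group P r)" and "\<Phi> \<in> flags P r"
  shows "g ` \<Phi> \<in> flags P r"
proof -
  have \<Phi>: "\<Phi> \<subseteq> P" "\<Phi> \<in> Chains r" "\<And>C. C \<in> Chains r \<Longrightarrow> C \<subseteq> P \<Longrightarrow> \<Phi> \<subseteq> C \<Longrightarrow> C = \<Phi>"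
    using assms(2) by (auto simp: flags_def)
  obtain h where h: "h \<in> carrier (aut_group P r)"
    "\<And>x. x \<in> P \<Longrightarrow> h (g x) = x" "\<And>x. x \<in> P \<Longrightarrow> g (h x) = x"
    using aut_inverse[OF g] by metis
  have chain: "f ` C \<in> Chains r" if "f \<in> carrier (aut_group P r)" "C \<subseteq> P" "C \<in> Chains r" for f C
    using that aut_iff[OF that(1)] by (auto simp: Chains_def subset_iff)
  have "C = g ` \<Phi>" if C: "C \<in> Chains r" "C \<subseteq> P" "g ` \<Phi> \<subseteq> C" for C
  proof -
    have "h ` C \<in> Chains r" "h ` C \<subseteq> P"
      using chain[OF h(1)] aut_closed[OF h(1)] C by auto
    moreover have "\<Phi> \<subseteq> h ` C"
    proof
      fix x assume "x \<in> \<Phi>"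
      then have "g x \<in> C" "h (g x) = x" using C(3) \<Phi>(1) h(2) by auto
      then show "x \<in> h ` C" by (metis imageI)
    qed
    ultimately have "h ` C = \<Phi>" using \<Phi>(3) by blast
    moreover have "g ` h ` C = C" using C(2) h(3) by (simp add: image_image subset_iff)
    ultimately show ?thesis by simp
  qed
  moreover have "g ` \<Phi> \<subseteq> P" using \<Phi>(1) aut_closed[OF g] by auto
  ultimately show ?thesis
    using chain[OF g \<Phi>(1,2)] by (auto simp: flags_def)
qed

lemma aut_image_face_section:
  assumes g: "g \<in> carrier (aut_group P r)" and "F \<in> P" "G \<in> P"
  shows "g ` face_section P r G F = face_section P r (g G) (g F)"
proof -
  obtain h where h: "h \<in> carrier (aut_group P r)"
    "\<And>x. x \<in> P \<Longrightarrow> h (g x) = x" "\<And>x. x \<in> P \<Longrightarrow> g (h x) = x"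
    using aut_inverse[OF g] by metis
  \<comment> \<open>The preimage of \<open>H\<close> lies between \<open>F\<close> and
    \<open>G\<close>, because \<open>g\<close> reflects the order.\<close>
  have "H \<in> g ` face_section P r G F" if "H \<in> face_section P r (g G) (g F)" for H
  proof -
    have H: "H \<in> P" "(g F, H) \<in> r" "(H, g G) \<in> r" using that by (auto simp: face_section_def)
    then have "h H \<in> face_section P r G F"
      using aut_iff[OF g, of F "h H"] aut_iff[OF g, of "h H" G] assms(2,3)
      by (auto simp: face_section_def h(3) aut_closed[OF h(1)])
    then show ?thesis using h(3)[OF H(1)] by (metis imageI)
  qed
  then show ?thesis
    using assms by (auto simp: face_section_def aut_iff[OF g] aut_closed[OF g])
qed

section \<open>Flags, adjacency and sections of a polytope\<close>

context abstract_polytope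
begin

section \<open>Order, rank and flags\<close>

lemma leq_in_P: "(x, y) \<in> r \<Longrightarrow> x \<in> P \<and> y \<in> P"
  and leq_refl: "x \<in> P \<Longrightarrow> (x, x) \<in> r"
  and leq_trans: "(x, y) \<in> r \<Longrightarrow> (y, z) \<in> r \<Longrightarrow> (x, z) \<in> r"
  and leq_antisym: "(x, y) \<in> r \<Longrightarrow> (y, x) \<in> r \<Longrightarrow> x = y"
  using partial_order
  by (auto simp: partial_order_on_def preorder_on_def refl_on_def trans_def antisym_def)

lemma rank_range: "x \<in> P \<Longrightarrow> rk x \<in> {-1..n}"
  using rank_onto by blast

lemma chain_leq:
  "C \<in> Chains r \<Longrightarrow> x \<in> C \<Longrightarrow> y \<in> C \<Longrightarrow> rk x \<le> rk y \<Longrightarrow> (x, y) \<in> r"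
  using rank_strict_mono[of y x] by (fastforce simp: Chains_def)

lemma chain_rank_inj:
  "C \<in> Chains r \<Longrightarrow> x \<in> C \<Longrightarrow> y \<in> C \<Longrightarrow> rk x = rk y \<Longrightarrow> x = y"
  using chain_leq[of C x y] chain_leq[of C y x] leq_antisym by simp

lemma flagD:
  assumes "\<Phi> \<in> flags P r"
  shows "\<Phi> \<subseteq> P" "\<Phi> \<in> Chains r"
  using assms by (auto simp: flags_def)

text \<open>\<open>P\<close> may be infinite, but \<open>rk\<close> is injective on a chain and
  takes values in a finite interval. Hence chain sizes are bounded, and a largest chain above
  \<open>C\<close> is maximal.\<close>

lemma chain_extends_to_flag:
  assumes "C \<in> Chains r" "C \<subseteq> P"
  obtains \<Phi> where "\<Phi> \<in> flags P r" "C \<subseteq> \<Phi>"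
proof -
  let ?Q = "\<lambda>D. D \<in> Chains r \<and> D \<subseteq> P \<and> C \<subseteq> D"
  have fin: "finite D" and bound: "card D \<le> card {-1..n}" if "D \<in> Chains r" "D \<subseteq> P" for D
  proof -
    have inj: "inj_on rk D" using chain_rank_inj[OF that(1)] by (auto intro: inj_onI)
    have sub: "rk ` D \<subseteq> {-1..n}" using that(2) rank_range by blast
    show "finite D" using inj_on_finite[OF inj sub] by simp
    show "card D \<le> card {-1..n}" using card_inj_on_le[OF inj sub] by simp
  qed
  have "\<exists>D. ?Q D \<and> (\<forall>D'. ?Q D' \<longrightarrow> card D' \<le> card D)"
    by (rule ex_has_greatest_nat[where b = "Suc (card {-1..n})" and k = C])
      (use assms bound in \<open>auto simp: less_Suc_eq_le\<close>)
  then obtain D where D: "?Q D" "\<And>D'. ?Q D' \<Longrightarrow> card D' \<le> card D" by blast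
  have "D' = D" if "D' \<in> Chains r" "D' \<subseteq> P" "D \<subseteq> D'" for D'
    using card_seteq[OF fin[OF that(1,2)] that(3)] D that by blast
  then have "D \<in> flags P r" using D(1) by (auto simp: flags_def)
  then show thesis using D(1) that by blast
qed

text \<open>Ranks are injective on a chain, so a chain that has a face of every rank leaves no rank
  free for a further face.\<close>

lemma flagI:
  assumes "C \<in> Chains r" "C \<subseteq> P" and ranks: "\<And>i. i \<in> {-1..n} \<Longrightarrow> \<exists>F\<in>C. rk F = i"
  shows "C \<in> flags P r"
proof -
  have "D = C" if D: "D \<in> Chains r" "D \<subseteq> P" "C \<subseteq> D" for D
  proof -
    have "x \<in> C" if "x \<in> D" for x
    proof -
      obtain F where "F \<in> C" "rk F = rk x" using ranks[OF rank_range, of x] \<open>x \<in> D\<close> D(2) by blast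
      then show ?thesis using chain_rank_inj[OF D(1)] D(3) that by blast
    qed
    then show ?thesis using D(3) by blast
  qed
  then show ?thesis using assms(1,2) by (auto simp: flags_def)
qed

lemma face_of_rank:
  assumes "\<Phi> \<in> flags P r" "i \<in> {-1..n}"
  shows "face_of_rank rk \<Phi> i \<in> \<Phi>" "rk (face_of_rank rk \<Phi> i) = i"
  using theI'[OF flag_ranks[OF assms]] by (auto simp: face_of_rank_def)

lemma face_of_rank_in_P:
  "\<Phi> \<in> flags P r \<Longrightarrow> i \<in> {-1..n} \<Longrightarrow> face_of_rank rk \<Phi> i \<in> P"
  using face_of_rank(1) flagD(1) by blast

lemma face_of_rank_eqI:
  assumes "\<Phi> \<in> flags P r" "F \<in> \<Phi>" "rk F = i"
  shows "face_of_rank rk \<Phi> i = F"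
proof -
  have "i \<in> {-1..n}" using rank_range flagD(1) assms by blast
  then show ?thesis
    using face_of_rank[OF assms(1)] chain_rank_inj flagD(2) assms by metis
qed

section \<open>Automorphisms preserve ranks\<close>

text \<open>By definition automorphisms only respect the order. Along a flag through
  \<open>F\<close>, the ranks of the images start at -1 or above and rise by at least one at each
  step.\<close>

lemma aut_rank_le:
  assumes g: "g \<in> carrier (aut_group P r)" and "F \<in> P"
  shows "rk F \<le> rk (g F)"
proof -
  have "{F} \<in> Chains r" using leq_refl assms(2) by (simp add: Chains_def)
  then obtain \<Phi> where \<Phi>: "\<Phi> \<in> flags P r" "F \<in> \<Phi>"
    using chain_extends_to_flag[of "{F}"] assms(2) by auto
  \<comment> \<open>The bound \<open>i \<le> n\<close> sits inside the claim because the integer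
    induction starts at -1 and has no upper end.\<close>
  have "i \<le> n \<longrightarrow> i \<le> rk (g (face_of_rank rk \<Phi> i))" if "-1 \<le> i" for i
    using that
  proof (induction i rule: int_ge_induct)
    case base
    then show ?case
      using rank_range[OF aut_closed[OF g face_of_rank_in_P[OF \<Phi>(1), of "-1"]]] by simp
  next
    case (step i)
    show ?case
    proof
      assume "i + 1 \<le> n"
      let ?x = "face_of_rank rk \<Phi> i" and ?y = "face_of_rank rk \<Phi> (i + 1)"
      have xy: "?x \<in> \<Phi>" "?y \<in> \<Phi>" "rk ?x = i" "rk ?y = i + 1"
        using face_of_rank[OF \<Phi>(1)] step \<open>i + 1 \<le> n\<close> by auto
      then have P: "?x \<in> P" "?y \<in> P" "(?x, ?y) \<in> r" "?x \<noteq> ?y"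
        using flagD[OF \<Phi>(1)] chain_leq by auto
      then have "(g ?x, g ?y) \<in> r" "g ?x \<noteq> g ?y"
        using aut_iff[OF g] aut_inj_on[OF g] by (auto simp: inj_on_def)
      then show "i + 1 \<le> rk (g ?y)"
        using rank_strict_mono step \<open>i + 1 \<le> n\<close> by fastforce
    qed
  qed
  moreover have "rk F \<in> {-1..n}" using rank_range assms(2) .
  ultimately show ?thesis using face_of_rank_eqI[OF \<Phi> refl] by (metis atLeastAtMost_iff)
qed

text \<open>The inequality is applied to \<open>g\<close> at \<open>F\<close> and to its inverse at
  \<open>g F\<close>.\<close>

lemma aut_rank:
  assumes g: "g \<in> carrier (aut_group P r)" and F: "F \<in> P"
  shows "rk (g F) = rk F"
proof -
  obtain h where h: "h \<in> carrier (aut_group P r)" "h (g F) = F"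
    using aut_inverse[OF g] F by metis
  then show ?thesis
    using aut_rank_le[OF g F] aut_rank_le[OF h(1) aut_closed[OF g F]] by simp
qed

lemma face_of_rank_image:
  assumes "g \<in> carrier (aut_group P r)" "\<Phi> \<in> flags P r" "i \<in> {-1..n}"
  shows "face_of_rank rk (g ` \<Phi>) i = g (face_of_rank rk \<Phi> i)"
  using assms face_of_rank[OF assms(2,3)]
  by (intro face_of_rank_eqI aut_image_flag) (auto simp: aut_rank face_of_rank_in_P)

section \<open>Adjacent flags\<close>

text \<open>Adding the least or the greatest face to a flag leaves it a chain, so every flag
  contains both. A face missing from some flag is therefore neither of them, and within \<Phi> these
  are the only faces of rank -1 and \<open>n\<close>.\<close>

lemma flag_rank_bounds:
  assumes "\<Phi> \<in> flags P r" "\<Psi> \<in> flags P r" "F \<in> \<Phi>" "F \<notin> \<Psi>"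
  shows "rk F \<in> {0..n - 1}"
proof -
  have in_flag: "G \<in> \<Theta>" if "\<Theta> \<in> flags P r" "G \<in> P" "(\<forall>H\<in>P. (G, H) \<in> r) \<or> (\<forall>H\<in>P. (H, G) \<in> r)"
    for G \<Theta>
  proof -
    have "insert G \<Theta> \<in> Chains r" "insert G \<Theta> \<subseteq> P"
      using flagD[OF that(1)] that(2,3) leq_refl by (auto simp: Chains_def subset_iff)
    then show ?thesis using that(1) by (auto simp: flags_def)
  qed
  have FP: "F \<in> P" using assms flagD by blast
  obtain B where B: "B \<in> P" "\<forall>G\<in>P. (B, G) \<in> r" using least_face(1) by blast
  obtain T where T: "T \<in> P" "\<forall>G\<in>P. (G, T) \<in> r" using greatest_face(1) by blast
  have "rk F \<noteq> -1"
    using chain_rank_inj[OF flagD(2)[OF assms(1)] assms(3), of B] in_flag least_face(2) B assms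
    by metis
  moreover have "rk F \<noteq> n"
    using chain_rank_inj[OF flagD(2)[OF assms(1)] assms(3), of T] in_flag greatest_face(2) T assms
    by metis
  ultimately show ?thesis using rank_range[OF FP] by auto
qed

text \<open>All three flags share the faces of rank \<open>k - 1\<close> and \<open>k + 1\<close>,
  so their \<open>k\<close>-faces lie in the two-element set \<open>?D\<close> of the diamond
  condition. The \<open>k\<close>-faces of \<Psi> and \<Theta> both differ from that of \<Phi>,
  hence are equal.\<close>

lemma adjacent_flag_unique:
  assumes \<Phi>: "\<Phi> \<in> flags P r" and k: "k \<in> {0..n - 1}"
    and \<Psi>: "\<Psi> \<in> flags P r" "\<Phi> - \<Psi> = {face_of_rank rk \<Phi> k}" "\<Psi> - \<Phi> = {face_of_rank rk \<Psi> k}"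
    and \<Theta>: "\<Theta> \<in> flags P r" "\<Phi> - \<Theta> = {face_of_rank rk \<Phi> k}" "\<Theta> - \<Phi> = {face_of_rank rk \<Theta> k}"
  shows "\<Psi> = \<Theta>"
proof -
  let ?F = "face_of_rank rk \<Phi> (k - 1)" and ?G = "face_of_rank rk \<Phi> (k + 1)"
  let ?D = "{H \<in> P. rk H = k \<and> (?F, H) \<in> r \<and> (H, ?G) \<in> r}"
  have k': "k - 1 \<in> {-1..n}" "k + 1 \<in> {-1..n}" "k \<in> {-1..n}" using k by auto
  have FG: "?F \<in> \<Phi>" "?G \<in> \<Phi>" "rk ?F = k - 1" "rk ?G = k + 1"
    using face_of_rank[OF \<Phi>] k' by auto
  \<comment> \<open>An inclusion instead of an equality, so that \<open>X\<close> may also be \<Phi>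
    itself.\<close>
  have D: "face_of_rank rk X k \<in> ?D"
    if X: "X \<in> flags P r" "\<Phi> - X \<subseteq> {face_of_rank rk \<Phi> k}" for X
  proof -
    have "rk (face_of_rank rk \<Phi> k) = k" using face_of_rank[OF \<Phi> k'(3)] by simp
    then have "?F \<in> X" "?G \<in> X" using X(2) FG by (auto simp: subset_iff)
    then show ?thesis
      using face_of_rank[OF X(1) k'(3)] face_of_rank_in_P[OF X(1) k'(3)] FG
        chain_leq[OF flagD(2)[OF X(1)]] by auto
  qed
  have "(?F, ?G) \<in> r" using FG flagD(2)[OF \<Phi>] chain_leq by auto
  then have "card ?D = 2" using diamond k FG by blast
  then obtain a b where ab: "?D = {a, b}" by (auto simp: card_2_iff)
  have "face_of_rank rk \<Phi> k \<in> {a, b}" "face_of_rank rk \<Psi> k \<in> {a, b}" "face_of_rank rk \<Theta> k \<in> {a, b}"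
    using D[OF \<Phi>] D[OF \<Psi>(1)] D[OF \<Theta>(1)] \<Psi>(2) \<Theta>(2) unfolding ab by auto
  moreover have "face_of_rank rk \<Psi> k \<noteq> face_of_rank rk \<Phi> k" "face_of_rank rk \<Theta> k \<noteq> face_of_rank rk \<Phi> k"
    using \<Psi>(2,3) \<Theta>(2,3) by blast+
  ultimately have "face_of_rank rk \<Psi> k = face_of_rank rk \<Theta> k" by (metis empty_iff insert_iff)
  then have "\<Phi> - \<Psi> = \<Phi> - \<Theta>" "\<Psi> - \<Phi> = \<Theta> - \<Phi>" using \<Psi>(2,3) \<Theta>(2,3) by simp_all
  then show ?thesis by blast
qed

text \<open>The diamond condition supplies a second face \<open>H\<close> between the neighbours of
  the \<open>k\<close>-face \<open>?K\<close>; replacing \<open>?K\<close> by \<open>H\<close> gives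
  the flag.\<close>

lemma adjacent_flag_exists:
  assumes \<Phi>: "\<Phi> \<in> flags P r" and k: "k \<in> {0..n - 1}"
  shows "\<exists>\<Psi>. \<Psi> \<in> flags P r \<and> \<Phi> - \<Psi> = {face_of_rank rk \<Phi> k} \<and> \<Psi> - \<Phi> = {face_of_rank rk \<Psi> k}"
proof -
  let ?F = "face_of_rank rk \<Phi> (k - 1)" and ?G = "face_of_rank rk \<Phi> (k + 1)"
    and ?K = "face_of_rank rk \<Phi> k"
  let ?D = "{H \<in> P. rk H = k \<and> (?F, H) \<in> r \<and> (H, ?G) \<in> r}"
  have k': "k - 1 \<in> {-1..n}" "k + 1 \<in> {-1..n}" "k \<in> {-1..n}" using k by auto
  have FG: "?F \<in> \<Phi>" "?G \<in> \<Phi>" "rk ?F = k - 1" "rk ?G = k + 1" "?K \<in> \<Phi>" "rk ?K = k"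
    using face_of_rank[OF \<Phi>] k' by auto
  note ch = flagD(2)[OF \<Phi>]
  have "(?F, ?G) \<in> r" using FG ch chain_leq by auto
  then have "card ?D = 2" using diamond k FG by blast
  then have "\<not> ?D \<subseteq> {?K}"
    using card_mono[of "{?K}" ?D] by fastforce
  then obtain H where H: "H \<in> P" "rk H = k" "(?F, H) \<in> r" "(H, ?G) \<in> r" "H \<noteq> ?K" by blast
  have HN: "H \<notin> \<Phi>" using face_of_rank_eqI[OF \<Phi> _ H(2)] H(5) by blast
  define \<Psi> where "\<Psi> = insert H (\<Phi> - {?K})"
  have comp: "(x, H) \<in> r \<or> (H, x) \<in> r" if "x \<in> \<Phi> - {?K}" for x
  proof -
    have "rk x \<noteq> k" using face_of_rank_eqI[OF \<Phi>, of x k] that by auto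
    \<comment> \<open>Ranks are integers: a rank other than \<open>k\<close> is at most
      \<open>k - 1\<close> or at least \<open>k + 1\<close>. So \<open>x\<close> lies below
      \<open>?F\<close> or above \<open>?G\<close>, and is comparable with \<open>H\<close>.\<close>
    then have "rk x \<le> rk ?F \<or> rk ?G \<le> rk x" unfolding FG(3,4) by linarith
    then have "(x, ?F) \<in> r \<or> (?G, x) \<in> r" using chain_leq[OF ch] that FG(1,2) by blast
    then show ?thesis using H(3,4) leq_trans by blast
  qed
  have "\<Psi> \<in> flags P r"
  proof (rule flagI)
    show "\<Psi> \<in> Chains r"
      using ch comp leq_refl[OF H(1)] by (auto simp: \<Psi>_def Chains_def)
    show "\<Psi> \<subseteq> P" using flagD(1)[OF \<Phi>] H(1) by (auto simp: \<Psi>_def)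
    show "\<exists>F\<in>\<Psi>. rk F = i" if "i \<in> {-1..n}" for i
      using face_of_rank[OF \<Phi> that] H(2) FG(6) unfolding \<Psi>_def
      by (cases "i = k") (auto intro!: bexI[of _ "face_of_rank rk \<Phi> i"])
  qed
  moreover from this have "face_of_rank rk \<Psi> k = H"
    using H(2) by (intro face_of_rank_eqI) (auto simp: \<Psi>_def)
  moreover have "\<Phi> - \<Psi> = {?K}" "\<Psi> - \<Phi> = {H}" using HN H(5) FG(5) unfolding \<Psi>_def by blast+
  ultimately show ?thesis by (intro exI[of _ \<Psi>]) simp
qed

text \<open>Existence and uniqueness together justify the definite description in
  \<open>adj_flag\<close>.\<close>

lemma adj_flag:
  assumes "\<Phi> \<in> flags P r" "k \<in> {0..n - 1}"
  shows "adj_flag P r rk k \<Phi> \<in> flags P r"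
    and "\<Phi> - adj_flag P r rk k \<Phi> = {face_of_rank rk \<Phi> k}"
proof -
  have "\<exists>!\<Psi>. \<Psi> \<in> flags P r \<and> \<Phi> - \<Psi> = {face_of_rank rk \<Phi> k} \<and> \<Psi> - \<Phi> = {face_of_rank rk \<Psi> k}"
    using adjacent_flag_exists[OF assms]
    by (rule ex_ex1I) (elim conjE, rule adjacent_flag_unique[OF assms])
  from theI'[OF this] show "adj_flag P r rk k \<Phi> \<in> flags P r"
    and "\<Phi> - adj_flag P r rk k \<Phi> = {face_of_rank rk \<Phi> k}"
    by (simp_all add: adj_flag_def)
qed

lemma face_of_rank_adj_flag:
  assumes "\<Phi> \<in> flags P r" "k \<in> {0..n - 1}" "i \<in> {-1..n}" "i \<noteq> k"
  shows "face_of_rank rk (adj_flag P r rk k \<Phi>) i = face_of_rank rk \<Phi> i"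
proof -
  have "rk (face_of_rank rk \<Phi> k) = k" using assms(2) face_of_rank(2)[OF assms(1), of k] by simp
  then have "face_of_rank rk \<Phi> i \<in> adj_flag P r rk k \<Phi>"
    using face_of_rank[OF assms(1,3)] adj_flag(2)[OF assms(1,2)] assms(4) by (metis DiffI singletonD)
  then show ?thesis
    using face_of_rank_eqI[OF adj_flag(1)[OF assms(1,2)]] face_of_rank(2)[OF assms(1,3)] by blast
qed

text \<open>The exchanged faces have equal rank: the face of \<open>Y\<close> of rank
  \<open>rk F\<close> cannot lie in \<open>X\<close>, where \<open>F\<close> is the only one of that
  rank, so it is \<open>G\<close>. The last conclusion is what later excludes the ranks of faces
  common to \<open>X\<close> and \<open>Y\<close>.\<close>

lemma differ_in_one_face_adj_flag:
  assumes "X \<in> flags P r" "Y \<in> flags P r" "differ_in_one_face X Y"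
  obtains m where "m \<in> {0..n - 1}" "Y = adj_flag P r rk m X" "face_of_rank rk X m \<notin> Y"
proof -
  obtain F G where FG: "X - Y = {F}" "Y - X = {G}"
    using assms(3) by (auto simp: differ_in_one_face_def)
  have m: "rk F \<in> {0..n - 1}" using flag_rank_bounds[OF assms(1,2)] FG(1) by blast
  have X: "face_of_rank rk X (rk F) = F" using face_of_rank_eqI[OF assms(1)] FG(1) by blast
  have Y: "face_of_rank rk Y (rk F) = G"
  proof -
    let ?H = "face_of_rank rk Y (rk F)"
    have H: "?H \<in> Y" "rk ?H = rk F" using face_of_rank[OF assms(2), of "rk F"] m by auto
    have "?H \<notin> X"
      using chain_rank_inj[OF flagD(2)[OF assms(1)], of ?H F] H FG(1) by blast
    then show ?thesis using H(1) FG(2) by blast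
  qed
  have "Y = adj_flag P r rk (rk F) X"
    unfolding adj_flag_def
    by (rule the_equality[symmetric])
      (use assms(2) FG X Y adjacent_flag_unique[OF assms(1) m] in auto)
  moreover have "face_of_rank rk X (rk F) \<notin> Y" using X FG(1) by auto
  ultimately show thesis using that m by blast
qed

section \<open>Sections and the flags that cut them out\<close>

text \<open>A section contains its two ends as least and greatest element, so antisymmetry recovers
  them from the set.\<close>

lemma face_section_eq_iff:
  assumes "(F, G) \<in> r" "(F', G') \<in> r"
  shows "face_section P r G F = face_section P r G' F' \<longleftrightarrow> F = F' \<and> G = G'"
proof
  have ends: "A \<in> face_section P r B A" "B \<in> face_section P r B A" if "(A, B) \<in> r" for A B
    using that leq_in_P[OF that] by (simp_all add: face_section_def leq_refl)
  assume "face_section P r G F = face_section P r G' F'"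
  then have "F \<in> face_section P r G' F'" "G \<in> face_section P r G' F'"
    "F' \<in> face_section P r G F" "G' \<in> face_section P r G F"
    using ends[OF assms(1)] ends[OF assms(2)] by simp_all
  then show "F = F' \<and> G = G'" by (simp add: face_section_def leq_antisym)
qed auto

lemma group_action_flags: "group_action (aut_group P r) (flags P r) (set_action (flags P r))"
  by (rule group_action_set_action) (auto simp: flagD aut_image_flag dest: flagD(1))

lemma group_action_sections:
  "group_action (aut_group P r) (sections P r rk i j) (set_action (sections P r rk i j))"
proof (rule group_action_set_action)
  show "X \<subseteq> P" if "X \<in> sections P r rk i j" for X
    using that by (auto simp: sections_def face_section_def)
  fix g X assume g: "g \<in> carrier (aut_group P r)" and "X \<in> sections P r rk i j"
  then obtain F G where FG: "X = face_section P r G F" "F \<in> P" "G \<in> P" "(F, G) \<in> r" "rk F = i" "rk G = j"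
    by (auto simp: sections_def)
  have "g ` X = face_section P r (g G) (g F)" using aut_image_face_section[OF g] FG by simp
  moreover have "g F \<in> P" "g G \<in> P" "(g F, g G) \<in> r" "rk (g F) = i" "rk (g G) = j"
    using FG g by (simp_all add: aut_closed[OF g] aut_iff[OF g] aut_rank[OF g])
  ultimately show "g ` X \<in> sections P r rk i j" unfolding sections_def by blast
qed

lemma face_of_rank_leq:
  "\<Phi> \<in> flags P r \<Longrightarrow> -1 \<le> i \<Longrightarrow> i \<le> j \<Longrightarrow> j \<le> n \<Longrightarrow>
    (face_of_rank rk \<Phi> i, face_of_rank rk \<Phi> j) \<in> r"
  using chain_leq[OF flagD(2)] face_of_rank by simp

text \<open>Regarding the section as a function of the flag lets flag orbits be transported to
  section orbits.\<close>

definition flag_section :: "int \<Rightarrow> int \<Rightarrow> 'a set \<Rightarrow> 'a set" where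
  "flag_section i j \<Phi> = face_section P r (face_of_rank rk \<Phi> j) (face_of_rank rk \<Phi> i)"

text \<open>The ends \<open>F\<close> and \<open>G\<close> of a section form a chain; any flag
  extending it has them as its faces of rank \<open>i\<close> and \<open>j\<close>.\<close>

lemma sections_eq_image_flag_section:
  assumes "-1 \<le> i" "i \<le> j" "j \<le> n"
  shows "sections P r rk i j = flag_section i j ` flags P r"
proof (intro equalityI subsetI)
  fix S assume "S \<in> sections P r rk i j"
  then obtain F G where FG: "S = face_section P r G F" "F \<in> P" "G \<in> P" "(F, G) \<in> r" "rk F = i" "rk G = j"
    by (auto simp: sections_def)
  have "{F, G} \<in> Chains r" using FG leq_refl by (auto simp: Chains_def)
  then obtain \<Phi> where \<Phi>: "\<Phi> \<in> flags P r" "F \<in> \<Phi>" "G \<in> \<Phi>"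
    using chain_extends_to_flag[of "{F, G}"] FG(2,3) by auto
  then have "S = flag_section i j \<Phi>"
    using face_of_rank_eqI FG by (simp add: flag_section_def)
  then show "S \<in> flag_section i j ` flags P r" using \<Phi>(1) by blast
next
  fix S assume "S \<in> flag_section i j ` flags P r"
  then obtain \<Phi> where \<Phi>: "\<Phi> \<in> flags P r" "S = flag_section i j \<Phi>" by blast
  have "i \<in> {-1..n}" "j \<in> {-1..n}" using assms by auto
  then show "S \<in> sections P r rk i j"
    using face_of_rank_leq[OF \<Phi>(1) assms] face_of_rank_in_P[OF \<Phi>(1)] face_of_rank(2)[OF \<Phi>(1)] \<Phi>(2)
    unfolding sections_def flag_section_def by blast
qed

text \<open>Equivariance of the passage from flags to sections, which rests on automorphisms
  preserving ranks.\<close>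

lemma image_flag_section:
  assumes "g \<in> carrier (aut_group P r)" "\<Phi> \<in> flags P r" "-1 \<le> i" "i \<le> j" "j \<le> n"
  shows "g ` flag_section i j \<Phi> = flag_section i j (g ` \<Phi>)"
  using assms aut_image_face_section[OF assms(1)] face_of_rank_in_P[OF assms(2)]
    face_of_rank_image[OF assms(1,2)]
  by (simp add: flag_section_def)

lemma flag_section_orbit:
  assumes "\<Psi> \<in> orbit (aut_group P r) (set_action (flags P r)) \<Phi>" "\<Phi> \<in> flags P r"
    and "-1 \<le> i" "i \<le> j" "j \<le> n"
  shows "flag_section i j \<Psi> \<in>
    orbit (aut_group P r) (set_action (sections P r rk i j)) (flag_section i j \<Phi>)"
proof -
  obtain g where "g \<in> carrier (aut_group P r)" "g ` \<Phi> = \<Psi>"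
    using assms(1,2) by (auto simp: orbit_set_action_iff)
  moreover have "flag_section i j \<Phi> \<in> sections P r rk i j"
    using sections_eq_image_flag_section assms by blast
  ultimately show ?thesis
    using image_flag_section assms by (auto simp: orbit_set_action_iff)
qed

section \<open>Two-orbit polytopes\<close>

lemma in_class_two_adj_flag_orbit_iff:
  assumes "in_class_two P r rk n I" "\<Phi> \<in> flags P r" "k \<in> {0..n - 1}"
  shows "adj_flag P r rk k \<Phi> \<in> orbit (aut_group P r) (set_action (flags P r)) \<Phi> \<longleftrightarrow> k \<in> I"
  using assms unfolding in_class_two_def by blast

text \<open>As \<open>k\<close> is not in \<open>I\<close>, the orbits of \<Phi> and its
  \<open>k\<close>-adjacent flag are distinct; there being only two orbits, they are all.\<close>

lemma in_class_two_flag_orbit_cases: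
  assumes "in_class_two P r rk n I" "\<Phi> \<in> flags P r" "k \<in> {0..n - 1} - I" "\<Psi> \<in> flags P r"
  shows "\<Psi> \<in> orbit (aut_group P r) (set_action (flags P r)) \<Phi> \<or>
    \<Psi> \<in> orbit (aut_group P r) (set_action (flags P r)) (adj_flag P r rk k \<Phi>)"
proof -
  interpret A: group_action "aut_group P r" "flags P r" "set_action (flags P r)"
    by (rule group_action_flags)
  let ?O = "orbit (aut_group P r) (set_action (flags P r))"
  let ?Os = "orbits (aut_group P r) (flags P r) (set_action (flags P r))"
  have adj: "adj_flag P r rk k \<Phi> \<in> flags P r" using adj_flag assms by auto
  have "?O \<Phi> \<noteq> ?O (adj_flag P r rk k \<Phi>)"
    using A.orbit_eq_iff[OF assms(2) adj] in_class_two_adj_flag_orbit_iff[OF assms(1,2)] assms(3)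
    by auto
  moreover have "card ?Os = 2" using assms(1) by (simp add: in_class_two_def two_orbit_def)
  moreover have "?O \<Phi> \<in> ?Os" "?O (adj_flag P r rk k \<Phi>) \<in> ?Os" "?O \<Psi> \<in> ?Os"
    using assms adj by (auto simp: orbits_def)
  ultimately have "?O \<Psi> = ?O \<Phi> \<or> ?O \<Psi> = ?O (adj_flag P r rk k \<Phi>)"
    by (auto simp: card_2_iff)
  then show ?thesis using A.orbit_refl[OF assms(4)] by auto
qed

text \<open>Strong flag-connectedness joins the flags by a path whose members all contain the common
  \<open>i\<close>- and \<open>j\<close>-faces. No step changes those ranks, so each changes a rank
  in \<open>I\<close> and stays within the orbit.\<close>

lemma in_class_two_orbit_if_same_faces:
  assumes "in_class_two P r rk n I" "{0..n - 1} - I \<subseteq> {i, j}" "i \<in> {-1..n}" "j \<in> {-1..n}"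
    and flags: "\<Phi> \<in> flags P r" "\<Psi> \<in> flags P r"
    and eq: "face_of_rank rk \<Phi> i = face_of_rank rk \<Psi> i" "face_of_rank rk \<Phi> j = face_of_rank rk \<Psi> j"
  shows "\<Psi> \<in> orbit (aut_group P r) (set_action (flags P r)) \<Phi>"
proof -
  interpret A: group_action "aut_group P r" "flags P r" "set_action (flags P r)"
    by (rule group_action_flags)
  have common: "face_of_rank rk \<Phi> i \<in> \<Phi> \<inter> \<Psi>" "face_of_rank rk \<Phi> j \<in> \<Phi> \<inter> \<Psi>"
    using face_of_rank(1) flags eq assms(3,4) by (metis IntI)+
  have rks: "rk (face_of_rank rk \<Phi> i) = i" "rk (face_of_rank rk \<Phi> j) = j"
    using face_of_rank(2) flags assms(3,4) by auto
  show ?thesis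
    using strongly_flag_connected[OF flags]
  proof (induction rule: rtrancl_induct)
    case base
    then show ?case using A.orbit_refl flags by blast
  next
    case (step X Y)
    then have XY: "X \<in> flags P r" "Y \<in> flags P r" "\<Phi> \<inter> \<Psi> \<subseteq> X" "\<Phi> \<inter> \<Psi> \<subseteq> Y" "differ_in_one_face X Y"
      by auto
    obtain m where m: "m \<in> {0..n - 1}" "Y = adj_flag P r rk m X" "face_of_rank rk X m \<notin> Y"
      using differ_in_one_face_adj_flag[OF XY(1,2,5)] by blast
    \<comment> \<open>The \<open>i\<close>- and \<open>j\<close>-faces of \<open>X\<close> are those
      of \<Phi>, which \<open>Y\<close> contains too; the \<open>m\<close>-face of \<open>X\<close>
      is lost in \<open>Y\<close>.\<close>
    have "face_of_rank rk X i \<in> Y" "face_of_rank rk X j \<in> Y"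
      using face_of_rank_eqI[OF XY(1) _ rks(1)] face_of_rank_eqI[OF XY(1) _ rks(2)] common XY(3,4)
      by (metis subsetD)+
    then have "m \<noteq> i" "m \<noteq> j" using m(3) by auto
    then have "m \<in> I" using assms(2) m(1) by blast
    then have "Y \<in> orbit (aut_group P r) (set_action (flags P r)) X"
      using in_class_two_adj_flag_orbit_iff[OF assms(1) XY(1) m(1)] m(2) by simp
    then show ?case using A.orbit_trans step.IH flags(1) XY(1,2) by blast
  qed
qed

section \<open>Section orbits\<close>

text \<open>With \<open>k\<close> outside \<open>{i, j}\<close>, the flag \<Phi> and its
  \<open>k\<close>-adjacent flag both cut out \<open>S\<close>, and every flag cutting out
  \<open>T\<close> is equivalent to one of them.\<close>

lemma in_class_two_sections_transitive:
  assumes two: "in_class_two P r rk n I" and ij: "-1 \<le> i" "i \<le> j" "j \<le> n"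
    and "\<not> {0..n - 1} - I \<subseteq> {i, j}"
  shows "transitive_action (aut_group P r) (sections P r rk i j) (set_action (sections P r rk i j))"
proof -
  interpret S: group_action "aut_group P r" "sections P r rk i j" "set_action (sections P r rk i j)"
    by (rule group_action_sections)
  obtain k where k: "k \<in> {0..n - 1} - I" "k \<noteq> i" "k \<noteq> j" using assms(5) by blast
  show ?thesis
  proof
    fix S T assume "S \<in> sections P r rk i j" "T \<in> sections P r rk i j"
    then obtain \<Phi> \<Psi> where \<Phi>: "\<Phi> \<in> flags P r" "S = flag_section i j \<Phi>"
      and \<Psi>: "\<Psi> \<in> flags P r" "T = flag_section i j \<Psi>"
      using sections_eq_image_flag_section[OF ij] by auto
    have "flag_section i j (adj_flag P r rk k \<Phi>) = S"
      using face_of_rank_adj_flag[OF \<Phi>(1)] k ij \<Phi>(2) by (simp add: flag_section_def)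
    moreover have "adj_flag P r rk k \<Phi> \<in> flags P r" using adj_flag(1)[OF \<Phi>(1)] k by blast
    ultimately have "T \<in> orbit (aut_group P r) (set_action (sections P r rk i j)) S"
      using in_class_two_flag_orbit_cases[OF two \<Phi>(1) k(1) \<Psi>(1)] flag_section_orbit[OF _ _ ij] \<Phi> \<Psi>
      by metis
    then show "\<exists>g\<in>carrier (aut_group P r). set_action (sections P r rk i j) g S = T"
      by (auto simp: orbit_def)
  qed
qed

lemma in_class_two_sections_orbits:
  assumes two: "in_class_two P r rk n I" and ij: "-1 \<le> i" "i \<le> j" "j \<le> n"
    and sub: "{0..n - 1} - I \<subseteq> {i, j}" and k: "k \<in> {0..n - 1} - I" and \<Phi>: "\<Phi> \<in> flags P r"
  defines "orb \<equiv> orbit (aut_group P r) (set_action (sections P r rk i j))"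
  shows "orbits (aut_group P r) (sections P r rk i j) (set_action (sections P r rk i j)) =
      {orb (flag_section i j \<Phi>), orb (flag_section i j (adj_flag P r rk k \<Phi>))}"
    and "orb (flag_section i j \<Phi>) \<noteq> orb (flag_section i j (adj_flag P r rk k \<Phi>))"
proof -
  interpret A: group_action "aut_group P r" "flags P r" "set_action (flags P r)"
    by (rule group_action_flags)
  interpret S: group_action "aut_group P r" "sections P r rk i j" "set_action (sections P r rk i j)"
    by (rule group_action_sections)
  let ?\<Psi> = "adj_flag P r rk k \<Phi>"
  have \<Psi>: "?\<Psi> \<in> flags P r" using adj_flag \<Phi> k by blast
  have sec: "flag_section i j X \<in> sections P r rk i j" if "X \<in> flags P r" for X
    using sections_eq_image_flag_section[OF ij] that by blast
  have all: "orb S \<in> {orb (flag_section i j \<Phi>), orb (flag_section i j ?\<Psi>)}" if "S \<in> sections P r rk i j" for S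
  proof -
    obtain X where X: "X \<in> flags P r" "S = flag_section i j X"
      using \<open>S \<in> _\<close> unfolding sections_eq_image_flag_section[OF ij] by blast
    then have "S \<in> orb (flag_section i j \<Phi>) \<or> S \<in> orb (flag_section i j ?\<Psi>)"
      using in_class_two_flag_orbit_cases[OF two \<Phi> k X(1)] flag_section_orbit[OF _ _ ij] \<Phi> \<Psi>
      unfolding orb_def by metis
    then show ?thesis
      using S.orbit_eq_iff[OF sec[OF \<Phi>] that] S.orbit_eq_iff[OF sec[OF \<Psi>] that]
      unfolding orb_def by auto
  qed
  have "orbits (aut_group P r) (sections P r rk i j) (set_action (sections P r rk i j)) =
      orb ` sections P r rk i j"
    by (auto simp: orbits_def orb_def)
  also have "\<dots> = {orb (flag_section i j \<Phi>), orb (flag_section i j ?\<Psi>)}"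
  proof (rule equalityI)
    show "orb ` sections P r rk i j \<subseteq> {orb (flag_section i j \<Phi>), orb (flag_section i j ?\<Psi>)}"
      using all by (rule image_subsetI)
    show "{orb (flag_section i j \<Phi>), orb (flag_section i j ?\<Psi>)} \<subseteq> orb ` sections P r rk i j"
      using sec[OF \<Phi>] sec[OF \<Psi>] by simp
  qed
  finally show
    "orbits (aut_group P r) (sections P r rk i j) (set_action (sections P r rk i j)) =
      {orb (flag_section i j \<Phi>), orb (flag_section i j ?\<Psi>)}" .
  show "orb (flag_section i j \<Phi>) \<noteq> orb (flag_section i j ?\<Psi>)"
  proof
    assume "orb (flag_section i j \<Phi>) = orb (flag_section i j ?\<Psi>)"
    then have "flag_section i j ?\<Psi> \<in> orb (flag_section i j \<Phi>)"
      using S.orbit_refl[OF sec[OF \<Psi>]] by (simp add: orb_def)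
    then obtain g where g: "g \<in> carrier (aut_group P r)"
      and "g ` flag_section i j \<Phi> = flag_section i j ?\<Psi>"
      unfolding orb_def using orbit_set_action_iff[OF sec[OF \<Phi>]] by metis
    then have "flag_section i j (g ` \<Phi>) = flag_section i j ?\<Psi>"
      using image_flag_section[OF g \<Phi> ij] by simp
    moreover have g\<Phi>: "g ` \<Phi> \<in> flags P r" using aut_image_flag[OF g \<Phi>] .
    \<comment> \<open>Equal sections have equal ends, so the two flags share their \<open>i\<close>-
      and \<open>j\<close>-faces.\<close>
    ultimately have "face_of_rank rk (g ` \<Phi>) i = face_of_rank rk ?\<Psi> i"
      "face_of_rank rk (g ` \<Phi>) j = face_of_rank rk ?\<Psi> j"
      using face_section_eq_iff face_of_rank_leq[OF _ ij] \<Psi> by (simp_all add: flag_section_def)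
    then have "?\<Psi> \<in> orbit (aut_group P r) (set_action (flags P r)) (g ` \<Phi>)"
      using in_class_two_orbit_if_same_faces[OF two sub _ _ g\<Phi> \<Psi>] ij by auto
    moreover have "g ` \<Phi> \<in> orbit (aut_group P r) (set_action (flags P r)) \<Phi>"
      using g \<Phi> by (auto simp: orbit_set_action_iff)
    ultimately have "?\<Psi> \<in> orbit (aut_group P r) (set_action (flags P r)) \<Phi>"
      using A.orbit_trans[OF \<Phi> g\<Phi> \<Psi>] by blast
    then show False using in_class_two_adj_flag_orbit_iff[OF two \<Phi>] k by blast
  qed
qed

text \<open>An automorphism taking \<open>S\<close> to \<open>T\<close> restricts to an order
  isomorphism between them.\<close>

lemma orbit_sections_imp_isomorphic:
  assumes "S \<in> sections P r rk i j"
    and "T \<in> orbit (aut_group P r) (set_action (sections P r rk i j)) S"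
  shows "poset_isomorphic r S T"
proof -
  obtain g where g: "g \<in> carrier (aut_group P r)" "g ` S = T"
    using assms(2) unfolding orbit_set_action_iff[OF assms(1)] by blast
  have S: "S \<subseteq> P" using assms(1) by (auto simp: sections_def face_section_def)
  have "bij_betw g S T"
    using inj_on_subset[OF aut_inj_on[OF g(1)] S] g(2) by (simp add: bij_betw_def)
  moreover have "\<forall>x\<in>S. \<forall>y\<in>S. (g x, g y) \<in> r \<longleftrightarrow> (x, y) \<in> r"
    using aut_iff[OF g(1)] S by blast
  ultimately show ?thesis unfolding poset_isomorphic_def by blast
qed

end

theorem theorem2:
  fixes P :: "'a set" and r :: "'a rel" and rk :: "'a \<Rightarrow> int" and n i j :: int and I :: "int set"
  assumes "abstract_polytope P r rk n"
    and "in_class_two P r rk n I"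
    and "I \<subset> {0..n - 1}"
    and "-1 \<le> i" and "i \<le> j" and "j \<le> n"
  shows "(\<not> {0..n - 1} - I \<subseteq> {i, j} \<longrightarrow>
      transitive_action (aut_group P r) (sections P r rk i j) (set_action (sections P r rk i j)) \<and>
      (\<forall>S\<in>sections P r rk i j. \<forall>T\<in>sections P r rk i j. poset_isomorphic r S T)) \<and>
    ({0..n - 1} - I \<subseteq> {i, j} \<longrightarrow>
      card (orbits (aut_group P r) (sections P r rk i j) (set_action (sections P r rk i j))) = 2 \<and>
      (\<forall>k \<in> {0..n - 1} - I. \<forall>\<Phi> \<in> flags P r.
        orbits (aut_group P r) (sections P r rk i j) (set_action (sections P r rk i j)) =
          {orbit (aut_group P r) (set_action (sections P r rk i j))
             (face_section P r (face_of_rank rk \<Phi> j) (face_of_rank rk \<Phi> i)),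
           orbit (aut_group P r) (set_action (sections P r rk i j))
             (face_section P r (face_of_rank rk (adj_flag P r rk k \<Phi>) j)
               (face_of_rank rk (adj_flag P r rk k \<Phi>) i))}))"
proof -
  interpret abstract_polytope P r rk n by fact
  note two = assms(2) and ij = assms(4-6)
  let ?S = "sections P r rk i j"
  have "transitive_action (aut_group P r) ?S (set_action ?S) \<and>
      (\<forall>S\<in>?S. \<forall>T\<in>?S. poset_isomorphic r S T)"
    if "\<not> {0..n - 1} - I \<subseteq> {i, j}"
  proof -
    interpret T: transitive_action "aut_group P r" ?S "set_action ?S"
      using that by (rule in_class_two_sections_transitive[OF two ij])
    have "poset_isomorphic r S T" if "S \<in> ?S" "T \<in> ?S" for S T
      using that T.all_equivalent[OF that] by (intro orbit_sections_imp_isomorphic) simp_all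
    then show ?thesis using T.transitive_action_axioms by blast
  qed
  moreover have "card (orbits (aut_group P r) ?S (set_action ?S)) = 2 \<and>
      (\<forall>k \<in> {0..n - 1} - I. \<forall>\<Phi> \<in> flags P r. orbits (aut_group P r) ?S (set_action ?S) =
        {orbit (aut_group P r) (set_action ?S) (flag_section i j \<Phi>),
         orbit (aut_group P r) (set_action ?S) (flag_section i j (adj_flag P r rk k \<Phi>))})"
    if sub: "{0..n - 1} - I \<subseteq> {i, j}"
  proof -
    note orbs = in_class_two_sections_orbits[OF two ij sub]
    \<comment> \<open>The count needs one concrete pair of representatives: \<open>k\<close> exists
      because \<open>I\<close> is a proper subset, and a flag because the empty chain extends to
      one.\<close>
    obtain k where k: "k \<in> {0..n - 1} - I" using assms(3) by blast
    obtain \<Phi> where "\<Phi> \<in> flags P r"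
      using chain_extends_to_flag[of "{}"] by (auto simp: Chains_def)
    then have "card (orbits (aut_group P r) ?S (set_action ?S)) = 2"
      using orbs[OF k] by simp
    then show ?thesis using orbs(1) by simp
  qed
  ultimately show ?thesis unfolding flag_section_def by simp
qed

end
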